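(* Suppose $\boldsymbol v=(v,0,0)$ and $\boldsymbol{\mathcal I}=(\mathcal I,0,0)$, with $|v|\le1$, $|\mathcal I|\le\mathcal D$, and $\mathcal D>0$. Let $\lambda_{\max}:=\max\big(|\lambda(\partial_{\mathcal U}\mathcal F^{1})|\big)$ denote the maximum magnitude of the eigenvalues of the spatial-flux Jacobian $\partial_{\mathcal U}\mathcal F^1$ of the two-moment system described in the context. Then $\lambda_{\max}\le1$.
   Context: Two-moment model (units with speed of light $1$): the primitive moments are $\mathcal M=(\mathcal D,\boldsymbol{\mathcal I})$ with $\mathcal D$ scalar and $\boldsymbol{\mathcal I}=(\mathcal I^1,\mathcal I^2,\mathcal I^3)$. For a given velocity $\boldsymbol v=(v^1,v^2,v^3)$ (held fixed in all differentiations), the conserved moments and the spatial flux in direction $x^1$ are $$\mathcal U=\begin{pmatrix}\mathcal D+v^i\mathcal I_i\\ \mathcal I_j+v^i\mathcal K_{ij}\end{pmatrix},\qquad \mathcal F^1=\begin{pmatrix}\mathcal I^1+v^1\mathcal D\\ \mathcal K^1{}_j+v^1\mathcal I_j\end{pmatrix},\qquad j=1,2,3,$$ with repeated indices summed over $1,2,3$ and indices raised and lowered by $\delta_{ij}$. The system is closed by the approximate Minerbo closure $$\mathcal K^{ij}=\mathsf k^{ij}\mathcal D,\qquad \mathsf k^{ij}=\tfrac12\big[(1-\psi_{\mathsf a})\delta^{ij}+(3\psi_{\mathsf a}-1)\hat{\mathsf n}^i\hat{\mathsf n}^j\big],\qquad \psi_{\mathsf a}(h)=\tfrac13+\tfrac2{15}(3h^2-h^3+3h^4),$$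 where $h=|\boldsymbol{\mathcal I}|/\mathcal D$ is the flux factor and $\hat{\mathsf n}^i=\mathcal I^i/|\boldsymbol{\mathcal I}|$ (the $\hat{\mathsf n}$ term vanishes at $\boldsymbol{\mathcal I}=0$ since $\psi_{\mathsf a}(0)=\frac13$). The spatial-flux Jacobian with respect to the conserved moments is $$\partial_{\mathcal U}\mathcal F^1=\Big(\frac{\partial\mathcal F^1}{\partial\mathcal M}\Big)\Big(\frac{\partial\mathcal U}{\partial\mathcal M}\Big)^{-1}.$$
   Formalization: The bound is stated where the conserved moments' Jacobian with respect to the primitive moments is invertible, shown to be exactly when v·I ≠ −D; in the corner v·I = −D (|v| = 1, |I| = D, opposite signs) it is singular and the flux Jacobian is undefined. *)

theory Defs
  imports "HOL-Analysis.Analysis"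
begin

text \<open>
  A moment vector has one scalar and three spatial components. It is a vector over the index type
  \<open>3 option\<close>: the entry at \<open>None\<close> is the scalar moment, the entry at \<open>Some j\<close> is the
  \<open>j\<close>-th component of the vector moment.
\<close>

type_synonym moments = "real ^ (3 option)"

definition mk_moments :: "real \<Rightarrow> real ^ 3 \<Rightarrow> moments" where
  "mk_moments D I = (\<chi> a. case a of None \<Rightarrow> D | Some j \<Rightarrow> I $ j)"

definition scalar_moment :: "moments \<Rightarrow> real" where
  "scalar_moment M = M $ None"

definition vector_moment :: "moments \<Rightarrow> real ^ 3" where
  "vector_moment M = (\<chi> j. M $ Some j)"

definition \<psi>\<^sub>a :: "real \<Rightarrow> real" where
  "\<psi>\<^sub>a h = 1/3 + 2/15 * (3 * h^2 - h^3 + 3 * h^4)"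

definition flux_factor :: "real \<Rightarrow> real ^ 3 \<Rightarrow> real" where
  "flux_factor D I = norm I / D"

text \<open>
  The unit vector in the direction of \<open>I\<close> is \<open>sgn I\<close>, which is \<open>0\<close> for \<open>I = 0\<close>; there the
  term containing it has the coefficient \<open>3 * \<psi>\<^sub>a 0 - 1 = 0\<close> anyway.
\<close>

definition eddington_tensor :: "real \<Rightarrow> real ^ 3 \<Rightarrow> real ^ 3 ^ 3" where
  "eddington_tensor D I =
     (let \<psi> = \<psi>\<^sub>a (flux_factor D I); n = sgn I
      in \<chi> i j. 1/2 * ((1 - \<psi>) * (if i = j then 1 else 0) + (3 * \<psi> - 1) * (n $ i) * (n $ j)))"

definition pressure_tensor :: "real \<Rightarrow> real ^ 3 \<Rightarrow> real ^ 3 ^ 3" where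
  "pressure_tensor D I = (\<chi> i j. eddington_tensor D I $ i $ j * D)"

definition conserved_moments :: "real ^ 3 \<Rightarrow> moments \<Rightarrow> moments" where
  "conserved_moments v M =
     (let D = scalar_moment M; I = vector_moment M; K = pressure_tensor D I
      in mk_moments (D + (\<Sum>i\<in>UNIV. v $ i * I $ i))
                    (\<chi> j. I $ j + (\<Sum>i\<in>UNIV. v $ i * K $ i $ j)))"

definition spatial_flux1 :: "real ^ 3 \<Rightarrow> moments \<Rightarrow> moments" where
  "spatial_flux1 v M =
     (let D = scalar_moment M; I = vector_moment M; K = pressure_tensor D I
      in mk_moments (I $ 1 + v $ 1 * D)
                    (\<chi> j. K $ 1 $ j + v $ 1 * I $ j))"

text \<open>
  \<open>matrix_inv\<close> is the inverse only if \<open>jacobian (conserved_moments v) (at M)\<close> is invertible;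
  otherwise its value, and so that of the flux Jacobian, is unspecified.
\<close>

definition flux_jacobian1 :: "real ^ 3 \<Rightarrow> moments \<Rightarrow> real ^ (3 option) ^ (3 option)" where
  "flux_jacobian1 v M =
     jacobian (spatial_flux1 v) (at M) ** matrix_inv (jacobian (conserved_moments v) (at M))"

text \<open>Eigenvalues of a real matrix are taken over the complex numbers.\<close>

definition eigenvalues :: "real ^ 'n ^ 'n \<Rightarrow> complex set" where
  "eigenvalues A = {l. \<exists>x. x \<noteq> 0 \<and> map_matrix complex_of_real A *v x = l *s x}"

definition lambda_max :: "real ^ 'n ^ 'n \<Rightarrow> real" where
  "lambda_max A = Max (cmod ` eigenvalues A)"

end

theory Submission
  imports Defs
begin

text \<open>
  The proof reduces every velocity to zero velocity. Let \<open>G\<close> be the flux at rest and \<open>A\<close> its Jacobian at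
  the given moments. For a velocity \<open>v\<close> along the first axis the conserved moments are \<open>M + v *\<^sub>R G M\<close> and
  the flux is \<open>G M + v *\<^sub>R M\<close>, so the two Jacobians are \<open>mat 1 + v *\<^sub>R A\<close> and \<open>A + v *\<^sub>R mat 1\<close>. The flux
  Jacobian is therefore a function of \<open>A\<close>, and its eigenvalues are the numbers \<open>(v + m) / (1 + v * m)\<close> for
  the eigenvalues \<open>m\<close> of \<open>A\<close> (\<open>eigenvalues_boost\<close>): characteristic speeds compose with \<open>v\<close> by relativistic
  velocity addition. This Moebius map preserves the closed unit disc (\<open>velocity_addition_le_1\<close>), so it
  suffices that the eigenvalues of \<open>A\<close> lie in it.

  For a momentum along the first axis, \<open>A\<close> splits into a transversal part, with the eigenvalue
  \<open>dK_perp a\<close>, and a \<open>2\<close> by \<open>2\<close> longitudinal part, with the characteristic equation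
  \<open>z\<^sup>2 = dK_dI a * z + dK_dD a\<close>, where \<open>a = I / D\<close>. The transversal eigenvalue is at most \<open>\<bar>a\<bar>\<close> in
  magnitude. The longitudinal ones lie in the unit disc by the Schur-Cohn criterion
  (\<open>quadratic_root_le_1\<close>); its hypotheses amount to \<open>- 1 \<le> \<psi>\<^sub>a h - h * \<psi>\<^sub>a' h\<close> and
  \<open>(1 - h) * \<psi>\<^sub>a' h \<le> 1 - \<psi>\<^sub>a h\<close> for \<open>h = \<bar>a\<bar>\<close>, the second of which is the convexity of \<open>\<psi>\<^sub>a\<close>
  together with \<open>\<psi>\<^sub>a 1 = 1\<close>.

  The matrix \<open>mat 1 + v *\<^sub>R A\<close> is singular only if \<open>1 + v * m = 0\<close> for an eigenvalue \<open>m\<close>. In the unit disc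
  this needs \<open>\<bar>v\<bar> = 1\<close> and \<open>m = - v\<close>, which happens exactly if \<open>a = - v\<close>, that is \<open>v * I = - D\<close>.

  At zero momentum neither \<open>norm I\<close> nor the unit vector along \<open>I\<close> is differentiable. The pressure tensor
  is, since the closure contains the norm only in terms such as \<open>norm I * (I $ i * I $ j)\<close>
  (\<open>pressure_tensor_eq\<close>, \<open>has_derivative_norm_times\<close>).
\<close>

section \<open>Eigenvalues under a boost\<close>

lemma map_matrix_of_real_mult:
  fixes A :: "real ^ 'n ^ 'm" and B :: "real ^ 'k ^ 'n"
  shows "map_matrix complex_of_real (A ** B) = map_matrix complex_of_real A ** map_matrix complex_of_real B"
  by (simp add: vec_eq_iff matrix_matrix_mult_def)

lemma map_matrix_of_real_mat_1: "map_matrix complex_of_real (mat 1) = mat 1"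
  by (simp add: vec_eq_iff mat_def)

lemma map_matrix_of_real_add_scaleR_vector:
  fixes A B :: "real ^ 'n ^ 'm"
  shows "map_matrix complex_of_real (A + v *\<^sub>R B) *v y =
         map_matrix complex_of_real A *v y + of_real v *s (map_matrix complex_of_real B *v y)"
  by (simp add: vec_eq_iff matrix_vector_mult_def sum_distrib_left algebra_simps sum.distrib)

lemma map_matrix_of_real_ker:
  fixes A :: "real ^ 'n ^ 'n"
  assumes "invertible A" and "map_matrix complex_of_real A *v y = 0"
  shows "y = 0"
proof -
  obtain B where "B ** A = mat 1"
    using assms(1) by (auto simp: invertible_def)
  then have "map_matrix complex_of_real B *v (map_matrix complex_of_real A *v y) = y"
    by (simp add: matrix_vector_mul_assoc map_matrix_of_real_mat_1 flip: map_matrix_of_real_mult)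
  then show ?thesis
    using assms(2) by simp
qed

lemma of_real_eigenvalue:
  fixes A :: "real ^ 'n ^ 'n"
  assumes "A *v x = m *\<^sub>R x" and "x \<noteq> 0"
  shows "complex_of_real m \<in> eigenvalues A"
proof -
  let ?y = "(\<chi> i. complex_of_real (x $ i)) :: complex ^ 'n"
  have "?y \<noteq> 0"
    using assms(2) by (auto simp: vec_eq_iff)
  moreover have "map_matrix complex_of_real A *v ?y = of_real m *s ?y"
  proof -
    have "(map_matrix complex_of_real A *v ?y) $ i = complex_of_real ((A *v x) $ i)" for i
      by (simp add: matrix_vector_mult_def)
    then show ?thesis
      by (simp add: vec_eq_iff assms(1))
  qed
  ultimately show ?thesis
    by (auto simp: eigenvalues_def)
qed

text \<open>
  An invertible real matrix has no complex kernel either, so \<open>1 + v * m\<close>, an eigenvalue of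
  \<open>mat 1 + v *\<^sub>R A\<close>, cannot vanish. Conversely, a real kernel vector is an eigenvector of \<open>A\<close> for
  \<open>- 1 / v\<close>.
\<close>

lemma invertible_one_plus_scaleR_iff:
  fixes A :: "real ^ 'n ^ 'n"
  shows "invertible (mat 1 + v *\<^sub>R A) \<longleftrightarrow> (\<forall>m\<in>eigenvalues A. 1 + of_real v * m \<noteq> 0)"
proof
  assume inv: "invertible (mat 1 + v *\<^sub>R A)"
  show "\<forall>m\<in>eigenvalues A. 1 + of_real v * m \<noteq> 0"
  proof
    fix m assume "m \<in> eigenvalues A"
    then obtain y where y: "y \<noteq> 0" "map_matrix complex_of_real A *v y = m *s y"
      by (auto simp: eigenvalues_def)
    then have "map_matrix complex_of_real (mat 1 + v *\<^sub>R A) *v y = (1 + of_real v * m) *s y"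
      by (simp add: map_matrix_of_real_add_scaleR_vector map_matrix_of_real_mat_1 vec_eq_iff algebra_simps)
    then show "1 + of_real v * m \<noteq> 0"
      using map_matrix_of_real_ker[OF inv, of y] y(1) by (metis vector_smult_lzero)
  qed
next
  assume ev: "\<forall>m\<in>eigenvalues A. 1 + of_real v * m \<noteq> 0"
  have "x = 0" if ker: "(mat 1 + v *\<^sub>R A) *v x = 0" for x
  proof (rule ccontr)
    assume "x \<noteq> 0"
    have eq: "x + v *\<^sub>R (A *v x) = 0"
      using ker by (simp add: matrix_vector_mult_add_rdistrib scaleR_matrix_vector_assoc)
    then have "v \<noteq> 0"
      using \<open>x \<noteq> 0\<close> by auto
    have "A *v x = (- 1 / v) *\<^sub>R x"
    proof -
      have "x = - (v *\<^sub>R (A *v x))"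
        using eq by (simp add: eq_neg_iff_add_eq_0)
      then have "(- 1 / v) *\<^sub>R x = (- 1 / v) *\<^sub>R (- (v *\<^sub>R (A *v x)))"
        by (rule arg_cong)
      then show ?thesis
        using \<open>v \<noteq> 0\<close> by simp
    qed
    then have "complex_of_real (- 1 / v) \<in> eigenvalues A"
      using \<open>x \<noteq> 0\<close> by (rule of_real_eigenvalue)
    then show False
      using ev \<open>v \<noteq> 0\<close> by fastforce
  qed
  then show "invertible (mat 1 + v *\<^sub>R A)"
    by (simp add: invertible_left_inverse matrix_left_invertible_ker)
qed

text \<open>
  If \<open>y\<close> is an eigenvector of \<open>A\<close>, then \<open>(mat 1 + v *\<^sub>R A) *v y\<close> is one of the boosted matrix. Conversely,
  an eigenvector \<open>(mat 1 + v *\<^sub>R A) *v y\<close> with eigenvalue \<open>l\<close> gives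
  \<open>(1 - l * v) *s (A *v y) = (l - v) *s y\<close>, which makes \<open>y\<close> an eigenvector of \<open>A\<close> unless \<open>l * v = 1\<close>.
\<close>

lemma eigenvalues_boost:
  fixes A :: "real ^ 'n ^ 'n"
  assumes inv: "invertible (mat 1 + v *\<^sub>R A)" and ne: "eigenvalues A \<noteq> {}"
  shows "eigenvalues ((A + v *\<^sub>R mat 1) ** matrix_inv (mat 1 + v *\<^sub>R A)) =
         (\<lambda>m. (of_real v + m) / (1 + of_real v * m)) ` eigenvalues A"
    (is "eigenvalues (?B ** matrix_inv ?C) = ?f ` _")
proof -
  let ?c = "map_matrix complex_of_real"
  have left: "?c (matrix_inv ?C) *v (?c ?C *v y) = y"
    and right: "?c ?C *v (?c (matrix_inv ?C) *v y) = y" for y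
    using someI_ex[OF inv[unfolded invertible_def]] unfolding matrix_inv_def
    by (simp_all add: matrix_vector_mul_assoc map_matrix_of_real_mat_1 flip: map_matrix_of_real_mult)
  have B: "?c ?B *v y = ?c A *v y + of_real v *s y" and C: "?c ?C *v y = y + of_real v *s (?c A *v y)" for y
    by (simp_all add: map_matrix_of_real_add_scaleR_vector map_matrix_of_real_mat_1)
  have J: "?c (?B ** matrix_inv ?C) *v x = ?c ?B *v (?c (matrix_inv ?C) *v x)" for x
    by (simp add: map_matrix_of_real_mult matrix_vector_mul_assoc)
  have nz: "1 + of_real v * m \<noteq> 0" if "m \<in> eigenvalues A" for m
    using inv that by (simp add: invertible_one_plus_scaleR_iff)
  show ?thesis
  proof (intro equalityI subsetI)
    fix l assume "l \<in> eigenvalues (?B ** matrix_inv ?C)"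
    then obtain x where x: "x \<noteq> 0" "?c (?B ** matrix_inv ?C) *v x = l *s x"
      by (auto simp: eigenvalues_def)
    define y where "y = ?c (matrix_inv ?C) *v x"
    have xy: "x = ?c ?C *v y"
      by (simp add: y_def right)
    then have "y \<noteq> 0"
      using x(1) by auto
    have "?c ?B *v y = l *s (?c ?C *v y)"
      using x(2) by (simp add: J xy left)
    then have pencil: "(1 - l * of_real v) *s (?c A *v y) = (l - of_real v) *s y"
      unfolding B C by (simp add: vec_eq_iff algebra_simps)
    show "l \<in> ?f ` eigenvalues A"
    proof (cases "l * of_real v = 1")
      case False
      define m where "m = (l - of_real v) / (1 - l * of_real v)"
      have "?c A *v y = m *s y"
        using pencil False by (simp add: m_def vec_eq_iff field_simps)
      then have "m \<in> eigenvalues A"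
        using \<open>y \<noteq> 0\<close> by (auto simp: eigenvalues_def)
      moreover have "l = ?f m"
      proof -
        have "m * (1 - l * of_real v) = l - of_real v"
          using False by (simp add: m_def)
        then show ?thesis
          using nz[OF \<open>m \<in> eigenvalues A\<close>] by (simp add: field_simps)
      qed
      ultimately show ?thesis
        by blast
    next
      \<comment> \<open>Here \<open>l = v\<close> and \<open>v\<^sup>2 = 1\<close>: the boosted matrix is \<open>v\<close> times the identity, and every eigenvalue of
        \<open>A\<close> is sent to \<open>v\<close>. So any one of them will do.\<close>
      case True
      then have "l = of_real v"
        using pencil \<open>y \<noteq> 0\<close> by simp
      moreover obtain m where "m \<in> eigenvalues A"
        using ne by blast
      moreover have "?f m = of_real v"
        using True \<open>l = of_real v\<close> nz[OF \<open>m \<in> eigenvalues A\<close>]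
        by (simp add: divide_eq_eq ring_distribs flip: mult.assoc)
      ultimately show ?thesis
        by force
    qed
  next
    fix l assume "l \<in> ?f ` eigenvalues A"
    then obtain m y where m: "m \<in> eigenvalues A" "l = ?f m"
      and y: "y \<noteq> 0" "?c A *v y = m *s y"
      by (auto simp: eigenvalues_def)
    define k where "k = 1 + of_real v * m"
    have "k \<noteq> 0" and l: "l * k = of_real v + m"
      using nz[OF m(1)] by (simp_all add: k_def m(2))
    have "?c ?C *v y = k *s y"
      unfolding C by (simp add: y(2) k_def vec_eq_iff algebra_simps)
    then have "?c (?B ** matrix_inv ?C) *v (k *s y) = ?c ?B *v y"
      using left[of y] by (simp add: J)
    also have "\<dots> = (of_real v + m) *s y"
      unfolding B by (simp add: y(2) vec_eq_iff algebra_simps)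
    also have "\<dots> = l *s (k *s y)"
      by (simp add: l)
    finally show "l \<in> eigenvalues (?B ** matrix_inv ?C)"
      using y(1) \<open>k \<noteq> 0\<close> by (auto simp: eigenvalues_def intro!: exI[of _ "k *s y"])
  qed
qed

text \<open>
  The reason is the identity \<open>(cmod (1 + v * m))\<^sup>2 - (cmod (v + m))\<^sup>2 = (1 - v\<^sup>2) * (1 - (cmod m)\<^sup>2)\<close>. The
  quotient is the relativistic composition of \<open>v\<close> and \<open>m\<close>.
\<close>

lemma velocity_addition_le_1:
  fixes m :: complex
  assumes "\<bar>v\<bar> \<le> 1" and "cmod m \<le> 1"
  shows "cmod ((of_real v + m) / (1 + of_real v * m)) \<le> 1"
proof -
  have "(cmod (1 + of_real v * m))\<^sup>2 - (cmod (of_real v + m))\<^sup>2 = (1 - v\<^sup>2) * (1 - (cmod m)\<^sup>2)"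
    by (simp add: cmod_power2) (simp add: power2_eq_square algebra_simps)
  moreover have "v\<^sup>2 \<le> 1" "(cmod m)\<^sup>2 \<le> 1"
    using assms by (simp_all add: abs_square_le_1 power_le_one)
  ultimately have "(cmod (of_real v + m))\<^sup>2 \<le> (cmod (1 + of_real v * m))\<^sup>2"
    by (smt (verit) mult_nonneg_nonneg)
  then have "cmod (of_real v + m) \<le> cmod (1 + of_real v * m)"
    by (rule power2_le_imp_le) simp
  then show ?thesis
    by (cases "1 + of_real v * m = 0") (simp_all add: norm_divide divide_le_eq)
qed

section \<open>Derivatives of vector-valued maps\<close>

lemma has_derivative_vec_componentwise:
  fixes f :: "'a::real_normed_vector \<Rightarrow> real ^ 'n"
  assumes "\<And>i. ((\<lambda>x. f x $ i) has_derivative (\<lambda>h. f' h $ i)) (at a within S)"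
  shows "(f has_derivative f') (at a within S)"
  unfolding has_derivative_componentwise_within[of f]
  using assms by (auto simp: Basis_vec_def inner_axis)

text \<open>
  At the origin the norm is not differentiable, but a differentiable factor that vanishes there restores
  differentiability. This is why the cubic terms of the closure cause no trouble at zero momentum.
\<close>

lemma has_derivative_norm_times:
  fixes x :: "'a::real_inner"
  assumes g: "(g has_derivative g') (at x)" and zero: "x = 0 \<Longrightarrow> g x = 0"
  shows "((\<lambda>y. norm y * g y) has_derivative (\<lambda>h. (sgn x \<bullet> h) * g x + norm x * g' h)) (at x)"
proof (cases "x = 0")
  case False
  then show ?thesis
    by (auto intro!: derivative_eq_intros has_derivative_norm g simp: algebra_simps inner_commute)
next
  case True
  have "g \<midarrow>0\<rightarrow> 0"
    using has_derivative_continuous[OF g] zero True by (simp add: continuous_at)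
  then have "(\<lambda>y. \<bar>g y\<bar>) \<midarrow>0\<rightarrow> 0"
    by (rule tendsto_rabs_zero)
  then have "(\<lambda>y. norm (norm y * g y) / norm y) \<midarrow>0\<rightarrow> 0"
    by (rule Lim_transform_eventually) (auto simp: eventually_at_filter abs_mult)
  then show ?thesis
    using True zero by (simp add: has_derivative_at)
qed

lemma jacobian_eq:
  fixes A :: "real ^ 'n ^ 'm"
  assumes "(f has_derivative (*v) A) (at x)"
  shows "jacobian f (at x) = A"
  using frechet_derivative_at[OF assms, symmetric] assms
  by (simp add: jacobian_def)

section \<open>The Jacobian of the flux at rest\<close>

lemma UNIV_option_3: "(UNIV :: 3 option set) = {None, Some 1, Some 2, Some 3}"
  by (simp add: UNIV_option_conv UNIV_3)

lemma moments_nth: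
  "M $ a = (case a of None \<Rightarrow> scalar_moment M | Some j \<Rightarrow> vector_moment M $ j)"
  by (simp add: scalar_moment_def vector_moment_def split: option.split)

text \<open>
  For a velocity along the first axis, the velocity terms of the conserved moments are \<open>v\<close> times the flux
  at rest, and those of the flux are \<open>v\<close> times the moments. So everything is determined by the Jacobian of
  the flux at rest.
\<close>

lemma conserved_moments_eq_add_flux:
  "conserved_moments (vector [v, 0, 0]) M = M + v *\<^sub>R spatial_flux1 0 M"
  by (simp add: vec_eq_iff conserved_moments_def spatial_flux1_def Let_def mk_moments_def
      moments_nth[of M] sum_3 split: option.split)

lemma spatial_flux1_eq_add_moments:
  "spatial_flux1 (vector [v, 0, 0]) M = spatial_flux1 0 M + v *\<^sub>R M"
  by (simp add: vec_eq_iff conserved_moments_def spatial_flux1_def Let_def mk_moments_def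
      moments_nth[of M] split: option.split)

text \<open>
  The factor \<open>3 * \<psi>\<^sub>a h - 1\<close> is divisible by \<open>h\<^sup>2\<close>, which cancels the singular direction vectors. What is
  left is rational in \<open>D\<close> and \<open>I\<close>, apart from terms in which \<open>norm I\<close> has a factor vanishing at \<open>I = 0\<close>.
  For \<open>D = 0\<close> both sides are 0 by division by zero.
\<close>

lemma pressure_tensor_eq:
  "pressure_tensor D I $ i $ j =
     (D / 3 - (3 * (I \<bullet> I) / D - norm I * (I \<bullet> I) / D\<^sup>2 + 3 * (I \<bullet> I)\<^sup>2 / D ^ 3) / 15) * (if i = j then 1 else 0)
     + (3 * (I $ i * I $ j) / D - norm I * (I $ i * I $ j) / D\<^sup>2 + 3 * ((I \<bullet> I) * (I $ i * I $ j)) / D ^ 3) / 5"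
proof (cases "D = 0 \<or> I = 0")
  case True
  then show ?thesis
    by (auto simp: pressure_tensor_def eddington_tensor_def \<psi>\<^sub>a_def flux_factor_def Let_def)
next
  case False
  define N where "N = norm I"
  have N: "N \<noteq> 0" and II: "I \<bullet> I = N\<^sup>2"
    using False by (simp_all add: N_def dot_square_norm)
  have n: "sgn I $ k = I $ k / N" for k
    by (simp add: sgn_div_norm N_def divide_inverse)
  show ?thesis
    using False N
    by (simp add: pressure_tensor_def eddington_tensor_def \<psi>\<^sub>a_def flux_factor_def Let_def n II flip: N_def)
       (simp add: field_simps power2_eq_square power3_eq_cube power4_eq_xxxx)
qed

text \<open>
  For a momentum along the first axis and \<open>a = I / D\<close>, these are the only nonzero partial derivatives
  of the first row of the pressure tensor: \<open>dK_dD a = \<psi>\<^sub>a h - h * \<psi>\<^sub>a' h\<close> is that of the entry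
  \<open>(1, 1)\<close> with respect to the scalar moment, \<open>dK_dI a = sgn a * \<psi>\<^sub>a' h\<close> that of the same entry with
  respect to the first momentum component, and \<open>dK_perp a = a * (3 * \<psi>\<^sub>a h - 1) / (2 * h\<^sup>2)\<close>, continued
  to \<open>h = 0\<close>, that of the entry \<open>(1, j)\<close> with respect to the momentum component \<open>j\<close> for \<open>j \<noteq> 1\<close>; here
  \<open>h = \<bar>a\<bar>\<close>. The sign of \<open>a\<close> records the direction of the momentum.
\<close>

definition dK_dD :: "real \<Rightarrow> real" where
  "dK_dD a = 1/3 - 2/15 * (3 * a\<^sup>2 - 2 * \<bar>a\<bar> * a\<^sup>2 + 9 * a ^ 4)"

definition dK_dI :: "real \<Rightarrow> real" where
  "dK_dI a = 2/5 * (2 * a - \<bar>a\<bar> * a + 4 * a ^ 3)"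

definition dK_perp :: "real \<Rightarrow> real" where
  "dK_perp a = (3 * a - \<bar>a\<bar> * a + 3 * a ^ 3) / 5"

definition rest_jacobian :: "real \<Rightarrow> real ^ (3 option) ^ (3 option)" where
  "rest_jacobian a = (\<chi> r c. case r of
      None \<Rightarrow> (if c = Some 1 then 1 else 0)
    | Some j \<Rightarrow>
       if j = 1 then (if c = None then dK_dD a else if c = Some 1 then dK_dI a else 0)
       else if c = Some j then dK_perp a else 0)"

lemma bounded_linear_scalar_moment: "bounded_linear scalar_moment"
  by (simp add: scalar_moment_def[abs_def] bounded_linear_vec_nth)

lemma bounded_linear_vector_moment: "bounded_linear vector_moment"
  unfolding linear_conv_bounded_linear[symmetric]
  by (intro linearI) (auto simp: vector_moment_def vec_eq_iff)

text \<open>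
  Every nonlinear term of \<open>pressure_tensor_eq\<close> is a numerator over a power of \<open>D\<close>. The numerators are
  differentiated one by one at a momentum along the first axis, where \<open>I\<close> may be 0 or negative.
\<close>

lemma has_derivative_spatial_flux1_0:
  assumes D: "D > 0"
  shows "(spatial_flux1 0 has_derivative (*v) (rest_jacobian (I / D))) (at (mk_moments D (vector [I, 0, 0])))"
    (is "(_ has_derivative _) (at ?M)")
proof (rule has_derivative_vec_componentwise)
  fix r
  define a where "a = I / D"
  have I: "I = a * D"
    using D by (simp add: a_def)
  let ?x = "vector [I, 0, 0] :: real ^ 3"
  have sM: "scalar_moment ?M = D" and vM: "vector_moment ?M = ?x"
    by (simp_all add: scalar_moment_def vector_moment_def mk_moments_def)
  have ds: "(scalar_moment has_derivative scalar_moment) (at ?M)"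
    by (rule bounded_linear_imp_has_derivative[OF bounded_linear_scalar_moment])
  have dv: "(vector_moment has_derivative vector_moment) (at ?M)"
    by (rule bounded_linear_imp_has_derivative[OF bounded_linear_vector_moment])
  have di: "((\<lambda>M. vector_moment M $ i) has_derivative (\<lambda>M. vector_moment M $ i)) (at ?M)" for i
    by (rule bounded_linear.has_derivative[OF bounded_linear_vec_nth dv])
  have norm: "norm ?x = \<bar>I\<bar>" and inner: "?x \<bullet> h = I * h $ 1" for h :: "real ^ 3"
    by (simp_all add: norm_vec_def L2_set_def inner_vec_def sum_3)
  have inner': "h \<bullet> ?x = I * h $ 1" for h
    using inner by (simp add: inner_commute)
  have sgn: "sgn ?x \<bullet> h = sgn I * h $ 1" for h
    by (simp add: sgn_div_norm norm inner)
  have dsq: "((\<lambda>M. vector_moment M \<bullet> vector_moment M) has_derivative (\<lambda>h. 2 * I * vector_moment h $ 1)) (at ?M)"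
    by (auto intro!: derivative_eq_intros dv simp: vM inner inner')
  have dnsq: "((\<lambda>M. norm (vector_moment M) * (vector_moment M \<bullet> vector_moment M)) has_derivative
      (\<lambda>h. 3 * \<bar>I\<bar> * I * vector_moment h $ 1)) (at ?M)"
  proof -
    have "((\<lambda>x :: real ^ 3. norm x * (x \<bullet> x)) has_derivative
      (\<lambda>h. (sgn ?x \<bullet> h) * (?x \<bullet> ?x) + norm ?x * (?x \<bullet> h + h \<bullet> ?x))) (at ?x)"
      by (rule has_derivative_norm_times) (auto intro!: derivative_eq_intros)
    then have "((\<lambda>x :: real ^ 3. norm x * (x \<bullet> x)) has_derivative
      (\<lambda>h. 3 * \<bar>I\<bar> * I * h $ 1)) (at (vector_moment ?M))"
      unfolding vM
      by (rule has_derivative_eq_rhs) (simp add: sgn norm inner inner' abs_sgn algebra_simps)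
    from has_derivative_compose[OF dv this] show ?thesis .
  qed
  have dnij: "((\<lambda>M. norm (vector_moment M) * (vector_moment M $ 1 * vector_moment M $ j)) has_derivative
      (\<lambda>h. (if j = 1 then 3 else 1) * \<bar>I\<bar> * I * vector_moment h $ j)) (at ?M)" for j
  proof -
    have "((\<lambda>x :: real ^ 3. norm x * (x $ 1 * x $ j)) has_derivative
      (\<lambda>h. (sgn ?x \<bullet> h) * (?x $ 1 * ?x $ j) + norm ?x * (?x $ 1 * h $ j + h $ 1 * ?x $ j))) (at ?x)"
      by (rule has_derivative_norm_times)
         (auto intro!: derivative_eq_intros bounded_linear_imp_has_derivative bounded_linear_vec_nth simp: vec_eq_iff)
    then have "((\<lambda>x :: real ^ 3. norm x * (x $ 1 * x $ j)) has_derivative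
      (\<lambda>h. (if j = 1 then 3 else 1) * \<bar>I\<bar> * I * h $ j)) (at (vector_moment ?M))"
      unfolding vM
      by (rule has_derivative_eq_rhs)
         (use exhaust_3[of j] in \<open>auto simp: sgn norm abs_sgn algebra_simps\<close>)
    from has_derivative_compose[OF dv this] show ?thesis .
  qed
  have dsqsq: "((\<lambda>M. (vector_moment M \<bullet> vector_moment M)\<^sup>2) has_derivative
      (\<lambda>h. 4 * I ^ 3 * vector_moment h $ 1)) (at ?M)"
    by (rule has_derivative_eq_rhs[OF has_derivative_power[OF dsq]])
       (simp add: vM inner power3_eq_cube mult_ac)
  have dij: "((\<lambda>M. vector_moment M $ 1 * vector_moment M $ j) has_derivative
      (\<lambda>h. (if j = 1 then 2 else 1) * I * vector_moment h $ j)) (at ?M)" for j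
    by (rule has_derivative_eq_rhs[OF has_derivative_mult[OF di di]])
       (use exhaust_3[of j] in \<open>auto simp: vM\<close>)
  have dsqij: "((\<lambda>M. (vector_moment M \<bullet> vector_moment M) * (vector_moment M $ 1 * vector_moment M $ j)) has_derivative
      (\<lambda>h. (if j = 1 then 4 else 1) * I ^ 3 * vector_moment h $ j)) (at ?M)" for j
    by (rule has_derivative_eq_rhs[OF has_derivative_mult[OF dsq dij]])
       (use exhaust_3[of j] in \<open>auto simp: vM inner power3_eq_cube mult_ac\<close>)
  have ddiv: "((\<lambda>M. u M / scalar_moment M ^ k) has_derivative
      (\<lambda>h. u' h / D ^ k - real k * u ?M * scalar_moment h / D ^ (Suc k))) (at ?M)"
    if "(u has_derivative u') (at ?M)" for u u' k
  proof (rule has_derivative_eq_rhs[OF has_derivative_divide[OF that has_derivative_power[OF ds]]])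
    show "scalar_moment ?M ^ k \<noteq> 0"
      using D by (simp add: sM)
  qed (use D in \<open>cases k; simp add: sM fun_eq_iff field_simps\<close>)
  note ddiv1 = ddiv[of _ _ 1, simplified]
  have div_const: "((\<lambda>M. u M / c) has_derivative (\<lambda>h. u' h / c)) (at ?M)"
    if "(u has_derivative u') (at ?M)" for u u' and c :: real
    using has_derivative_mult_left[OF that, of "1 / c"] by simp
  show "((\<lambda>M. spatial_flux1 0 M $ r) has_derivative (\<lambda>h. (rest_jacobian (I / D) *v h) $ r)) (at ?M)"
  proof (cases r)
    case None
    then show ?thesis
      using di[of 1]
      by (simp add: spatial_flux1_def Let_def mk_moments_def rest_jacobian_def matrix_vector_mult_def
          UNIV_option_3 vector_moment_def)
  next
    case (Some j)
    have flux: "spatial_flux1 0 M $ Some j = pressure_tensor (scalar_moment M) (vector_moment M) $ 1 $ j" for M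
      by (simp add: spatial_flux1_def Let_def mk_moments_def)
    show ?thesis
      unfolding Some flux pressure_tensor_eq
      \<comment> \<open>Put \<open>I = a * D\<close>: then every power of \<open>D\<close> cancels, also under the absolute value, and both
        sides become polynomials in \<open>a\<close> and \<open>\<bar>a\<bar>\<close>.\<close>
      by (rule has_derivative_eq_rhs,
          (rule has_derivative_add has_derivative_diff has_derivative_mult_left
             has_derivative_mult_right div_const ddiv1 ddiv[of _ _ 2] ddiv[of _ _ 3]
             dsq dnsq dnij dsqsq dsqij dij ds)+)
         (use exhaust_3[of j] D in \<open>elim disjE;
           simp add: fun_eq_iff vM sM norm inner rest_jacobian_def matrix_vector_mult_def
             UNIV_option_3 dK_dD_def dK_dI_def dK_perp_def;
           simp add: scalar_moment_def vector_moment_def;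
           simp add: I abs_mult;
           simp add: power_mult_distrib field_simps power2_eq_square power3_eq_cube
             power4_eq_xxxx\<close>)
  qed
qed

section \<open>Eigenvalues of the Jacobian at rest\<close>

text \<open>
  The Schur-Cohn criterion for a real quadratic. Two conjugate nonreal roots have product \<open>- c\<close>. A real
  root larger than 1 in absolute value is impossible because, for \<open>t = \<bar>z\<bar>\<close>, the equation gives
  \<open>(t - 1) * (t + c) \<le> 0\<close>.
\<close>

lemma quadratic_root_le_1:
  fixes z :: complex and p c :: real
  assumes root: "z\<^sup>2 = of_real p * z + of_real c" and "- 1 \<le> c" and "\<bar>p\<bar> \<le> 1 - c"
  shows "cmod z \<le> 1"
proof -
  have re: "(Re z)\<^sup>2 - (Im z)\<^sup>2 = p * Re z + c" and im: "2 * Re z * Im z = p * Im z"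
    using arg_cong[OF root, of Re] arg_cong[OF root, of Im] by (simp_all add: power2_eq_square)
  show ?thesis
  proof (cases "Im z = 0")
    case False
    then have "p = 2 * Re z"
      using im by simp
    then have "p * Re z = 2 * (Re z)\<^sup>2"
      by (simp add: power2_eq_square)
    then have "(cmod z)\<^sup>2 \<le> 1"
      using re \<open>- 1 \<le> c\<close> by (simp add: cmod_power2)
    then show ?thesis
      by (simp add: abs_square_le_1)
  next
    case True
    define t where "t = \<bar>Re z\<bar>"
    have "t\<^sup>2 = p * Re z + c"
      using re True by (simp add: t_def)
    also have "p * Re z \<le> (1 - c) * t"
      unfolding t_def by (metis abs_ge_self abs_mult assms(3) order_trans abs_ge_zero mult_right_mono)
    finally have "(t - 1) * (t + c) \<le> 0"
      by (simp add: power2_eq_square algebra_simps)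
    then have "t \<le> 1"
      using \<open>- 1 \<le> c\<close> by (smt (verit) mult_pos_pos)
    then show ?thesis
      using True by (simp add: t_def cmod_def)
  qed
qed

lemma rest_jacobian_mult_vec:
  "map_matrix complex_of_real (rest_jacobian a) *v x = l *s x \<longleftrightarrow>
   x $ Some 1 = l * x $ None \<and>
   of_real (dK_dD a) * x $ None + of_real (dK_dI a) * x $ Some 1 = l * x $ Some 1 \<and>
   of_real (dK_perp a) * x $ Some 2 = l * x $ Some 2 \<and>
   of_real (dK_perp a) * x $ Some 3 = l * x $ Some 3"
  by (simp add: vec_eq_iff rest_jacobian_def matrix_vector_mult_def UNIV_option_3 split_option_all forall_3)

text \<open>
  The matrix is block diagonal: a companion matrix for the scalar moment and the first momentum component,
  and \<open>dK_perp a\<close> on the two transversal components.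
\<close>

lemma eigenvalues_rest_jacobian:
  "eigenvalues (rest_jacobian a) =
     insert (of_real (dK_perp a)) {z. z\<^sup>2 = of_real (dK_dI a) * z + of_real (dK_dD a)}"
proof (intro equalityI subsetI)
  fix l assume "l \<in> eigenvalues (rest_jacobian a)"
  then obtain x :: "complex ^ (3 option)" where x: "x \<noteq> 0" "x $ Some 1 = l * x $ None"
    "of_real (dK_dD a) * x $ None + of_real (dK_dI a) * x $ Some 1 = l * x $ Some 1"
    "of_real (dK_perp a) * x $ Some 2 = l * x $ Some 2"
    "of_real (dK_perp a) * x $ Some 3 = l * x $ Some 3"
    by (auto simp: eigenvalues_def rest_jacobian_mult_vec)
  show "l \<in> insert (of_real (dK_perp a)) {z. z\<^sup>2 = of_real (dK_dI a) * z + of_real (dK_dD a)}"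
  proof (cases "l = of_real (dK_perp a)")
    case False
    then have "x $ Some 2 = 0" "x $ Some 3 = 0"
      using x(4,5) by auto
    then have "x $ None \<noteq> 0"
      using x(1,2) by (auto simp: vec_eq_iff split_option_all forall_3)
    moreover have "x $ None * l\<^sup>2 = x $ None * (of_real (dK_dI a) * l + of_real (dK_dD a))"
      using x(3) unfolding x(2) by (simp add: power2_eq_square algebra_simps)
    ultimately show ?thesis
      by simp
  qed simp
next
  fix l :: complex assume "l \<in> insert (of_real (dK_perp a)) {z. z\<^sup>2 = of_real (dK_dI a) * z + of_real (dK_dD a)}"
  then consider "l = of_real (dK_perp a)" | "l\<^sup>2 = of_real (dK_dI a) * l + of_real (dK_dD a)"
    by blast
  then show "l \<in> eigenvalues (rest_jacobian a)"
  proof cases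
    case 1
    then show ?thesis
      unfolding eigenvalues_def mem_Collect_eq rest_jacobian_mult_vec
      by (intro exI[of _ "axis (Some 2) 1"]) (simp add: axis_def vec_eq_iff)
  next
    case 2
    let ?x = "(\<chi> i. if i = None then 1 else if i = Some 1 then l else 0) :: complex ^ (3 option)"
    have "?x \<noteq> 0"
      by (auto simp: vec_eq_iff)
    with 2 show ?thesis
      unfolding eigenvalues_def mem_Collect_eq rest_jacobian_mult_vec
      by (intro exI[of _ ?x]) (simp add: power2_eq_square algebra_simps)
  qed
qed

lemma finite_quadratic_roots: "finite {z :: complex. z\<^sup>2 = b * z + c}"
proof -
  have "{z. z\<^sup>2 = b * z + c} = {z. poly [: - c, - b, 1 :] z = 0}"
    by (auto simp: power2_eq_square algebra_simps)
  moreover have "finite {z. poly [: - c, - b, 1 :] z = 0}"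
    by (rule poly_roots_finite) simp
  ultimately show ?thesis
    by simp
qed

text \<open>
  The bound by \<open>\<bar>a\<bar>\<close> instead of 1 shows that the transversal speed is that of light only for \<open>\<bar>a\<bar> = 1\<close>.
\<close>

lemma dK_perp_le:
  assumes "\<bar>a\<bar> \<le> 1"
  shows "\<bar>dK_perp a\<bar> \<le> \<bar>a\<bar>"
proof -
  define k where "k = (3 - \<bar>a\<bar> + 3 * a\<^sup>2) / 5"
  have "a\<^sup>2 \<le> \<bar>a\<bar>"
    using assms mult_left_le[of "\<bar>a\<bar>" "\<bar>a\<bar>"] by (simp add: power2_eq_square)
  moreover have "0 \<le> a\<^sup>2"
    by simp
  ultimately have "0 \<le> k" and "k \<le> 1"
    using assms by (simp_all add: k_def)
  moreover have "dK_perp a = a * k"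
    by (simp add: dK_perp_def k_def field_simps power2_eq_square power3_eq_cube)
  ultimately show ?thesis
    by (simp add: abs_mult mult_left_le)
qed

lemma dK_dD_ge:
  assumes "\<bar>a\<bar> \<le> 1"
  shows "- 1 \<le> dK_dD a"
proof -
  define h where "h = \<bar>a\<bar>"
  have h: "0 \<le> h" "h \<le> 1" "a\<^sup>2 = h\<^sup>2" "a ^ 4 = h ^ 4"
    using assms by (simp_all add: h_def)
  have "dK_dD a + 1 = 2/15 * ((1 - h)\<^sup>2 * (1 + 2 * h) + 9 * (1 - h ^ 4))"
    unfolding dK_dD_def h h_def[symmetric] by (simp add: field_simps power2_eq_square power4_eq_xxxx)
  moreover have "0 \<le> (1 - h)\<^sup>2 * (1 + 2 * h) + 9 * (1 - h ^ 4)"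
    using h by (simp add: power_le_one)
  ultimately have "0 \<le> dK_dD a + 1"
    by simp
  then show ?thesis
    by simp
qed

text \<open>
  The second hypothesis of the Schur-Cohn criterion in quantitative form. The left-hand side is the
  smaller value of the longitudinal characteristic polynomial at 1 and \<open>- 1\<close>. It vanishes at \<open>\<bar>a\<bar> = 1\<close>,
  where both longitudinal eigenvalues equal \<open>a\<close>. That it vanishes nowhere else is what identifies the
  singular case.
\<close>

lemma one_minus_dK_dD_minus_dK_dI:
  assumes "\<bar>a\<bar> \<le> 1"
  shows "1 - dK_dD a - \<bar>dK_dI a\<bar> = 2/15 * (1 - \<bar>a\<bar>)\<^sup>2 * (5 + 4 * \<bar>a\<bar> + 9 * a\<^sup>2)"
proof -
  define h where "h = \<bar>a\<bar>"
  have h: "h \<le> 1" "a\<^sup>2 = h\<^sup>2" "a ^ 4 = h ^ 4"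
    using assms by (simp_all add: h_def)
  have "dK_dI a = 2/5 * (a * (2 - h + 4 * h\<^sup>2))"
    unfolding h(2)[symmetric] by (simp add: dK_dI_def h_def algebra_simps power2_eq_square power3_eq_cube)
  moreover have "0 \<le> 2 - h + 4 * h\<^sup>2"
    using h(1) by (simp add: add_nonneg_nonneg)
  ultimately have "\<bar>dK_dI a\<bar> = 2/5 * (h * (2 - h + 4 * h\<^sup>2))"
    by (simp only: abs_mult) (simp add: h_def)
  then show ?thesis
    unfolding dK_dD_def h h_def[symmetric] by (simp add: field_simps power2_eq_square power4_eq_xxxx)
qed

lemma eigenvalues_rest_jacobian_le_1:
  assumes a: "\<bar>a\<bar> \<le> 1" and m: "m \<in> eigenvalues (rest_jacobian a)"
  shows "cmod m \<le> 1"
proof -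
  from m consider "m = of_real (dK_perp a)" | "m\<^sup>2 = of_real (dK_dI a) * m + of_real (dK_dD a)"
    unfolding eigenvalues_rest_jacobian by blast
  then show ?thesis
  proof cases
    case 1
    then show ?thesis
      using dK_perp_le[OF a] a by simp
  next
    case 2
    have "0 \<le> 2/15 * (1 - \<bar>a\<bar>)\<^sup>2 * (5 + 4 * \<bar>a\<bar> + 9 * a\<^sup>2)"
      by simp
    then show ?thesis
      using one_minus_dK_dD_minus_dK_dI[OF a] by (intro quadratic_root_le_1[OF 2 dK_dD_ge[OF a]]) linarith
  qed
qed

text \<open>
  Both \<open>v\<close> and the eigenvalue \<open>m\<close> are at most 1 in magnitude, so \<open>v * m = - 1\<close> forces \<open>\<bar>v\<bar> = 1\<close> and
  \<open>m = - v\<close>. An eigenvalue of magnitude 1 at \<open>- v\<close> requires \<open>\<bar>a\<bar> = 1\<close>, where all eigenvalues equal \<open>a\<close>.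
\<close>

lemma boost_singular_iff:
  assumes v: "\<bar>v\<bar> \<le> 1" and a: "\<bar>a\<bar> \<le> 1"
  shows "(\<exists>m\<in>eigenvalues (rest_jacobian a). 1 + of_real v * m = 0) \<longleftrightarrow> v * a = - 1"
proof
  assume va: "v * a = - 1"
  then have "\<bar>v\<bar> * \<bar>a\<bar> = 1"
    by (simp flip: abs_mult)
  then have "\<bar>a\<bar> = 1"
    using v a mult_le_one[of "\<bar>v\<bar>" "\<bar>a\<bar>"] mult_left_le_one_le[of "\<bar>a\<bar>" "\<bar>v\<bar>"] by simp
  then have "dK_perp a = a"
    by (auto simp: dK_perp_def abs_if split: if_splits)
  then have "1 + of_real v * complex_of_real (dK_perp a) = 0"
    using arg_cong[OF va, of complex_of_real] by simp
  then show "\<exists>m\<in>eigenvalues (rest_jacobian a). 1 + of_real v * m = 0"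
    unfolding eigenvalues_rest_jacobian by blast
next
  assume "\<exists>m\<in>eigenvalues (rest_jacobian a). 1 + of_real v * m = 0"
  then obtain m where m: "m \<in> eigenvalues (rest_jacobian a)" and vm: "of_real v * m = - 1"
    by (auto simp: add_eq_0_iff)
  have "\<bar>v\<bar> * cmod m = 1"
    using arg_cong[OF vm, of cmod] by (simp add: norm_mult)
  then have "\<bar>v\<bar> = 1"
    using v eigenvalues_rest_jacobian_le_1[OF a m] mult_left_le[of "cmod m" "\<bar>v\<bar>"] by simp
  then have v2: "v * v = 1"
    by (auto simp: abs_if split: if_splits)
  have mv: "m = of_real (- v)"
  proof -
    have "m = of_real (v * v) * m"
      by (simp add: v2)
    also have "\<dots> = of_real v * (of_real v * m)"
      by (simp add: mult.assoc)
    finally show ?thesis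
      by (simp add: vm)
  qed
  from m consider "m = of_real (dK_perp a)" | "m\<^sup>2 = of_real (dK_dI a) * m + of_real (dK_dD a)"
    unfolding eigenvalues_rest_jacobian by blast
  then have "\<bar>a\<bar> = 1 \<and> (dK_perp a = - v \<or> 1 = - (dK_dI a * v) + dK_dD a)"
  proof cases
    case 1
    then have "dK_perp a = - v"
      using mv by (metis of_real_eq_iff)
    then show ?thesis
      using dK_perp_le[OF a] a \<open>\<bar>v\<bar> = 1\<close> by simp
  next
    case 2
    have "complex_of_real (v * v) = of_real (- (dK_dI a * v) + dK_dD a)"
      using 2 unfolding mv by (simp add: power2_eq_square)
    then have root: "1 = - (dK_dI a * v) + dK_dD a"
      unfolding v2 by (metis of_real_eq_iff)
    moreover have "- (dK_dI a * v) \<le> \<bar>dK_dI a\<bar>"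
      using abs_ge_minus_self[of "dK_dI a * v"] by (simp add: abs_mult \<open>\<bar>v\<bar> = 1\<close>)
    ultimately have "(1 - \<bar>a\<bar>)\<^sup>2 * (5 + 4 * \<bar>a\<bar> + 9 * a\<^sup>2) \<le> 0"
      using one_minus_dK_dD_minus_dK_dI[OF a] by simp
    moreover have "0 < 5 + 4 * \<bar>a\<bar> + 9 * a\<^sup>2"
      by (simp add: add_pos_nonneg)
    ultimately have "\<bar>a\<bar> = 1"
      by (simp add: mult_le_0_iff)
    with root show ?thesis
      by simp
  qed
  with \<open>\<bar>v\<bar> = 1\<close> show "v * a = - 1"
    by (auto simp: dK_perp_def dK_dI_def dK_dD_def abs_if split: if_splits)
qed

theorem proposition2:
  fixes v I D :: real and vel :: "real ^ 3" and M :: moments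
  defines "vel \<equiv> vector [v, 0, 0]" and "M \<equiv> mk_moments D (vector [I, 0, 0])"
  assumes "\<bar>v\<bar> \<le> 1" and "\<bar>I\<bar> \<le> D" and "D > 0"
  shows "(invertible (jacobian (conserved_moments vel) (at M)) \<longleftrightarrow> v * I \<noteq> - D) \<and>
         (invertible (jacobian (conserved_moments vel) (at M)) \<longrightarrow>
            lambda_max (flux_jacobian1 vel M) \<le> 1)"
proof -
  define a where "a = I / D"
  have a: "\<bar>a\<bar> \<le> 1"
    using assms(4,5) by (simp add: a_def abs_divide)
  let ?A = "rest_jacobian a"
  have dG: "(spatial_flux1 0 has_derivative (*v) ?A) (at M)"
    unfolding M_def a_def using assms(5) by (rule has_derivative_spatial_flux1_0)
  have "(conserved_moments vel has_derivative (\<lambda>h. h + v *\<^sub>R (?A *v h))) (at M)"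
    unfolding vel_def conserved_moments_eq_add_flux[abs_def] by (intro derivative_intros dG)
  then have jac_U: "jacobian (conserved_moments vel) (at M) = mat 1 + v *\<^sub>R ?A"
    by (intro jacobian_eq, elim has_derivative_eq_rhs)
       (simp add: fun_eq_iff matrix_vector_mult_add_rdistrib scaleR_matrix_vector_assoc)
  have "(spatial_flux1 vel has_derivative (\<lambda>h. ?A *v h + v *\<^sub>R h)) (at M)"
    unfolding vel_def spatial_flux1_eq_add_moments[abs_def] by (intro derivative_intros dG)
  then have jac_F: "jacobian (spatial_flux1 vel) (at M) = ?A + v *\<^sub>R mat 1"
    by (intro jacobian_eq, elim has_derivative_eq_rhs)
       (simp add: fun_eq_iff matrix_vector_mult_add_rdistrib flip: scaleR_matrix_vector_assoc)
  have "v * I = - D \<longleftrightarrow> v * a = - 1"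
    using assms(5) by (simp add: a_def field_simps)
  then have inv_iff: "invertible (mat 1 + v *\<^sub>R ?A) \<longleftrightarrow> v * I \<noteq> - D"
    using boost_singular_iff[OF assms(3) a] by (auto simp: invertible_one_plus_scaleR_iff)
  moreover have "lambda_max (flux_jacobian1 vel M) \<le> 1" if inv: "invertible (mat 1 + v *\<^sub>R ?A)"
  proof -
    have ne: "eigenvalues ?A \<noteq> {}" and fin: "finite (eigenvalues ?A)"
      by (simp_all add: eigenvalues_rest_jacobian finite_quadratic_roots)
    show ?thesis
      unfolding lambda_max_def flux_jacobian1_def jac_U jac_F eigenvalues_boost[OF inv ne]
      using ne fin velocity_addition_le_1[OF assms(3) eigenvalues_rest_jacobian_le_1[OF a]]
      by (subst Max_le_iff) auto
  qed
  ultimately show ?thesis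
    unfolding jac_U by blast
qed

end
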